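(* Let $G$ be a $\sigma$-compact Polish group. Then $\perp^{nm}=\perp^{o}$ is the maximum strongly admissible geometry for $G$. That is: (i) $\perp^{nm}$ and $\perp^{o}$ coincide on every $G$-structure; (ii) the ideal scheme of meager ideals (which induces $\perp^{nm}$) is strongly admissible; and (iii) for every strongly admissible ideal scheme $\mathcal{I}$ on $G$, $\perp^{\mathcal{I}}\le\perp^{nm}$.
   Context: An ideal scheme $\mathcal{I}=\{\mathcal{I}_H\}_H$ of $G$ assigns to each closed subgroup $H$ of $G$ an ideal $\mathcal{I}_H$ of subsets of $H$. Below, $K<H$ means "$K$ is a subgroup of $H$" (not necessarily proper). The scheme is strongly admissible if: 1. ($\sigma$-ideal) every $\mathcal{I}_H$ is a $\sigma$-ideal; 2. (Invariance) every $\mathcal{I}_H$ is $H$-invariant (closed under translation by elements of $H$), and $g^{-1}\mathcal{I}_H g:=\{g^{-1}Xg:X\in\mathcal{I}_H\}=\mathcal{I}_{g^{-1}Hg}$ for every closed subgroup $H$ and $g\in G$; 3. (Transitivity) for all closed subgroups $K_1>K_2>K_3$ and $H<K_1$: [$(H\cap K_2)K_3\notin\mathcal{I}_{K_2}$ and $HK_2\notin\mathcal{I}_{K_1}$] if and only if $HK_3\notin\mathcal{I}_{K_1}$; 4. (Dichotomy for closed subgroups) for all closed subgroups $K<H$: $K\in\mathcal{I}_H$ if and only if $H/K$ is uncountable. A $G$-structure is a set $M$ with an action of $G$ such that every point stabilizer is closed in $G$. $G_A$ denotes the pointwise stabilizer of a subset or tuple $A$ of $M$, and $Ca$ denotes the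 union of $C$ with (the entries of) $a$. For finite tuples or subsets $a,b,C$ of $M$: $a\mathrel{\perp}^{\mathcal{I}}_C b$ means $G_{Ca}G_{Cb}\notin\mathcal{I}_{G_C}$; $a\mathrel{\perp}^{nm}_C b$ means $G_{Ca}G_{Cb}$ is non-meager in $G_C$ (this is $\perp^{\mathcal{I}}$ for $\mathcal{I}_H$ the ideal of meager subsets of $H$); $a\mathrel{\perp}^{o}_C b$ means $G_{Ca}G_{Cb}$ is open in $G_C$. For strongly admissible $\mathcal{I}$, $(G,\perp^{\mathcal{I}})$ is called a strongly admissible geometry for $G$. Rank: for a $G$-structure $M$, $a\in M^n$ and finite $A\subset M$, the rank $\mathrm{rk}^M_{\mathcal{I}}(a/A)$ (an ordinal or $\infty$) is defined by: $\mathrm{rk}^M_{\mathcal{I}}(a/A)\ge 0$ always; $\mathrm{rk}^M_{\mathcal{I}}(a/A)\ge\alpha+1$ if there is a finite $B$ with $A\subset B\subset M$ such that $a\mathrel{\perp}^{\mathcal{I}}_A B$ fails and $\mathrm{rk}^M_{\mathcal{I}}(a/B)\ge\alpha$; for limit $\lambda$, $\mathrm{rk}^M_{\mathcal{I}}(a/A)\ge\lambda$ if it is $\ge\alpha$ for all $\alpha<\lambda$; $\mathrm{rk}^M_{\mathcal{I}}(a/A)=\sup\{\alpha:\mathrm{rk}^M_{\mathcal{I}}(a/A)\ge\alpha\}$, which is $\infty$ if this holds for all ordinals $\alpha$. Order: for strongly admissible $\mathcal{I},\mathcal{J}$, $\perp^{\mathcal{I}}\le\perp^{\mathcal{J}}$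 means that $\mathrm{rk}^M_{\mathcal{I}}(a/A)\le\mathrm{rk}^M_{\mathcal{J}}(a/A)$ for every $G$-structure $M$, every tuple $a\in M^n$ and every finite $A\subset M$. *)

theory Defs
  imports
    "HOL-Analysis.Analysis"
    "HOL-Algebra.Group_Action"
    "HOL-Algebra.Left_Coset"
    "HOL-Library.Extended"
begin

section \<open>Topological groups, meager sets\<close>

definition nowhere_dense_in :: "'a topology \<Rightarrow> 'a set \<Rightarrow> bool" where
  "nowhere_dense_in X S \<longleftrightarrow> S \<subseteq> topspace X \<and> X interior_of (X closure_of S) = {}"

definition meager_in :: "'a topology \<Rightarrow> 'a set \<Rightarrow> bool" where
  "meager_in X S \<longleftrightarrow> (\<exists>N :: nat \<Rightarrow> 'a set. (\<forall>n. nowhere_dense_in X (N n)) \<and> S = (\<Union>n. N n))"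

definition sigma_compact_space :: "'a topology \<Rightarrow> bool" where
  "sigma_compact_space X \<longleftrightarrow>
     (\<exists>K :: nat \<Rightarrow> 'a set. (\<forall>n. compactin X (K n)) \<and> topspace X = (\<Union>n. K n))"

definition Polish_space :: "'a topology \<Rightarrow> bool" where
  "Polish_space X \<longleftrightarrow> completely_metrizable_space X \<and> separable_space X"

definition topological_group :: "('g, 'z) monoid_scheme \<Rightarrow> 'g topology \<Rightarrow> bool" where
  "topological_group G T \<longleftrightarrow>
     group G \<and> topspace T = carrier G \<and>
     continuous_map (prod_topology T T) T (\<lambda>(x, y). x \<otimes>\<^bsub>G\<^esub> y) \<and>
     continuous_map T T (\<lambda>x. inv\<^bsub>G\<^esub> x)"

definition sigma_compact_Polish_group :: "('g, 'z) monoid_scheme \<Rightarrow> 'g topology \<Rightarrow> bool" where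
  "sigma_compact_Polish_group G T \<longleftrightarrow>
     topological_group G T \<and> Polish_space T \<and> sigma_compact_space T"

definition closed_subgroup :: "('g, 'z) monoid_scheme \<Rightarrow> 'g topology \<Rightarrow> 'g set \<Rightarrow> bool" where
  "closed_subgroup G T H \<longleftrightarrow> subgroup H G \<and> closedin T H"


section \<open>Ideal schemes\<close>

definition ideal_on :: "'a set \<Rightarrow> 'a set set \<Rightarrow> bool" where
  "ideal_on H \<I> \<longleftrightarrow>
     \<I> \<subseteq> Pow H \<and> {} \<in> \<I> \<and>
     (\<forall>X\<in>\<I>. \<forall>Y. Y \<subseteq> X \<longrightarrow> Y \<in> \<I>) \<and>
     (\<forall>X\<in>\<I>. \<forall>Y\<in>\<I>. X \<union> Y \<in> \<I>)"

definition sigma_ideal_on :: "'a set \<Rightarrow> 'a set set \<Rightarrow> bool" where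
  "sigma_ideal_on H \<I> \<longleftrightarrow>
     ideal_on H \<I> \<and> (\<forall>X :: nat \<Rightarrow> 'a set. (\<forall>n. X n \<in> \<I>) \<longrightarrow> (\<Union>n. X n) \<in> \<I>)"

text \<open>A scheme is a function on all sets of group elements, but only its values at closed
  subgroups are ever constrained or used.\<close>

type_synonym 'g ideal_scheme = "'g set \<Rightarrow> 'g set set"

definition is_ideal_scheme ::
  "('g, 'z) monoid_scheme \<Rightarrow> 'g topology \<Rightarrow> 'g ideal_scheme \<Rightarrow> bool" where
  "is_ideal_scheme G T \<I> \<longleftrightarrow> (\<forall>H. closed_subgroup G T H \<longrightarrow> ideal_on H (\<I> H))"

definition conj_set :: "('g, 'z) monoid_scheme \<Rightarrow> 'g \<Rightarrow> 'g set \<Rightarrow> 'g set" where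
  "conj_set G g X = (\<lambda>x. inv\<^bsub>G\<^esub> g \<otimes>\<^bsub>G\<^esub> x \<otimes>\<^bsub>G\<^esub> g) ` X"

definition scheme_sigma ::
  "('g, 'z) monoid_scheme \<Rightarrow> 'g topology \<Rightarrow> 'g ideal_scheme \<Rightarrow> bool" where
  "scheme_sigma G T \<I> \<longleftrightarrow> (\<forall>H. closed_subgroup G T H \<longrightarrow> sigma_ideal_on H (\<I> H))"

text \<open>Translations are taken on both sides; given the conjugation clause (with \<open>g \<in> H\<close>),
  closure under left and under right translations are equivalent.\<close>

definition scheme_invariant ::
  "('g, 'z) monoid_scheme \<Rightarrow> 'g topology \<Rightarrow> 'g ideal_scheme \<Rightarrow> bool" where
  "scheme_invariant G T \<I> \<longleftrightarrow>
     (\<forall>H. closed_subgroup G T H \<longrightarrow>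
        (\<forall>h\<in>H. \<forall>X\<in>\<I> H. h <#\<^bsub>G\<^esub> X \<in> \<I> H \<and> X #>\<^bsub>G\<^esub> h \<in> \<I> H)) \<and>
     (\<forall>H. closed_subgroup G T H \<longrightarrow>
        (\<forall>g\<in>carrier G. conj_set G g ` \<I> H = \<I> (conj_set G g H)))"

definition scheme_transitive ::
  "('g, 'z) monoid_scheme \<Rightarrow> 'g topology \<Rightarrow> 'g ideal_scheme \<Rightarrow> bool" where
  "scheme_transitive G T \<I> \<longleftrightarrow>
     (\<forall>K1 K2 K3 H.
        closed_subgroup G T K1 \<and> closed_subgroup G T K2 \<and> closed_subgroup G T K3 \<and>
        closed_subgroup G T H \<and> K3 \<subseteq> K2 \<and> K2 \<subseteq> K1 \<and> H \<subseteq> K1 \<longrightarrow>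
        ((H \<inter> K2) <#>\<^bsub>G\<^esub> K3 \<notin> \<I> K2 \<and> H <#>\<^bsub>G\<^esub> K2 \<notin> \<I> K1 \<longleftrightarrow> H <#>\<^bsub>G\<^esub> K3 \<notin> \<I> K1))"

text \<open>\<open>lcosets\<^bsub>G\<lparr>carrier := H\<rparr>\<^esub> K\<close> is the coset space \<open>H/K\<close>.\<close>

definition scheme_dichotomy ::
  "('g, 'z) monoid_scheme \<Rightarrow> 'g topology \<Rightarrow> 'g ideal_scheme \<Rightarrow> bool" where
  "scheme_dichotomy G T \<I> \<longleftrightarrow>
     (\<forall>K H. closed_subgroup G T K \<and> closed_subgroup G T H \<and> K \<subseteq> H \<longrightarrow>
        (K \<in> \<I> H \<longleftrightarrow> uncountable (lcosets\<^bsub>G\<lparr>carrier := H\<rparr>\<^esub> K)))"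

definition strongly_admissible ::
  "('g, 'z) monoid_scheme \<Rightarrow> 'g topology \<Rightarrow> 'g ideal_scheme \<Rightarrow> bool" where
  "strongly_admissible G T \<I> \<longleftrightarrow>
     is_ideal_scheme G T \<I> \<and> scheme_sigma G T \<I> \<and> scheme_invariant G T \<I> \<and>
     scheme_transitive G T \<I> \<and> scheme_dichotomy G T \<I>"

definition meager_scheme :: "'g topology \<Rightarrow> 'g ideal_scheme" where
  "meager_scheme T H = {X. meager_in (subtopology T H) X}"


section \<open>Structures and independence relations\<close>

definition G_structure ::
  "('g, 'z) monoid_scheme \<Rightarrow> 'g topology \<Rightarrow> 'm set \<Rightarrow> ('g \<Rightarrow> 'm \<Rightarrow> 'm) \<Rightarrow> bool" where
  "G_structure G T M \<phi> \<longleftrightarrow>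
     group_action G M \<phi> \<and> (\<forall>x\<in>M. closedin T (stabilizer G \<phi> x))"

definition pointwise_stabilizer ::
  "('g, 'z) monoid_scheme \<Rightarrow> ('g \<Rightarrow> 'm \<Rightarrow> 'm) \<Rightarrow> 'm set \<Rightarrow> 'g set" where
  "pointwise_stabilizer G \<phi> A = {g \<in> carrier G. \<forall>x\<in>A. \<phi> g x = x}"

text \<open>\<open>stab_product G \<phi> a C b\<close> is $G_{Ca} G_{Cb}$. Independence depends on tuples only through
  their sets of entries, so its arguments are sets; a tuple \<open>xs\<close> enters as \<open>set xs\<close>.\<close>

definition stab_product ::
  "('g, 'z) monoid_scheme \<Rightarrow> ('g \<Rightarrow> 'm \<Rightarrow> 'm) \<Rightarrow> 'm set \<Rightarrow> 'm set \<Rightarrow> 'm set \<Rightarrow> 'g set" where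
  "stab_product G \<phi> a C b =
     pointwise_stabilizer G \<phi> (C \<union> a) <#>\<^bsub>G\<^esub> pointwise_stabilizer G \<phi> (C \<union> b)"

definition indep ::
  "'g ideal_scheme \<Rightarrow> ('g, 'z) monoid_scheme \<Rightarrow> ('g \<Rightarrow> 'm \<Rightarrow> 'm) \<Rightarrow>
   'm set \<Rightarrow> 'm set \<Rightarrow> 'm set \<Rightarrow> bool" where
  "indep \<I> G \<phi> a C b \<longleftrightarrow> stab_product G \<phi> a C b \<notin> \<I> (pointwise_stabilizer G \<phi> C)"

definition indep_nm ::
  "('g, 'z) monoid_scheme \<Rightarrow> 'g topology \<Rightarrow> ('g \<Rightarrow> 'm \<Rightarrow> 'm) \<Rightarrow>
   'm set \<Rightarrow> 'm set \<Rightarrow> 'm set \<Rightarrow> bool" where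
  "indep_nm G T \<phi> a C b \<longleftrightarrow>
     \<not> meager_in (subtopology T (pointwise_stabilizer G \<phi> C)) (stab_product G \<phi> a C b)"

definition indep_o ::
  "('g, 'z) monoid_scheme \<Rightarrow> 'g topology \<Rightarrow> ('g \<Rightarrow> 'm \<Rightarrow> 'm) \<Rightarrow>
   'm set \<Rightarrow> 'm set \<Rightarrow> 'm set \<Rightarrow> bool" where
  "indep_o G T \<phi> a C b \<longleftrightarrow>
     openin (subtopology T (pointwise_stabilizer G \<phi> C)) (stab_product G \<phi> a C b)"

lemma indep_meager_scheme: "indep (meager_scheme T) G \<phi> = indep_nm G T \<phi>"
  by (simp add: fun_eq_iff indep_def indep_nm_def meager_scheme_def)


section \<open>Rank\<close>

text \<open>HOL has no type of all ordinals. An ordinal is represented by an element of an arbitrary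
  well-ordered type \<open>'o\<close> (standing for the order type of its set of predecessors). Every ordinal
  arises this way for some \<open>'o\<close>, so statements about all ordinals are made for a
  free type variable \<open>'o\<close>.\<close>

definition is_zero_ord :: "'o::wellorder \<Rightarrow> bool" where
  "is_zero_ord \<alpha> \<longleftrightarrow> (\<forall>\<beta>. \<alpha> \<le> \<beta>)"

definition is_succ_ord :: "'o::wellorder \<Rightarrow> 'o \<Rightarrow> bool" where
  "is_succ_ord \<alpha> \<beta> \<longleftrightarrow> \<alpha> < \<beta> \<and> (\<forall>\<gamma>. \<alpha> < \<gamma> \<longrightarrow> \<beta> \<le> \<gamma>)"

definition is_limit_ord :: "'o::wellorder \<Rightarrow> bool" where
  "is_limit_ord \<alpha> \<longleftrightarrow> \<not> is_zero_ord \<alpha> \<and> (\<forall>\<beta>. \<not> is_succ_ord \<beta> \<alpha>)"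

text \<open>\<open>rank_ge \<I> G M \<phi> a \<alpha> A\<close>: the rank of the tuple \<open>a\<close> over \<open>A\<close> is at least \<open>\<alpha>\<close>.
  Exactly one rule applies to each \<open>\<alpha>\<close>.\<close>

inductive rank_ge ::
  "'g ideal_scheme \<Rightarrow> ('g, 'z) monoid_scheme \<Rightarrow> 'm set \<Rightarrow> ('g \<Rightarrow> 'm \<Rightarrow> 'm) \<Rightarrow> 'm list \<Rightarrow>
   'o::wellorder \<Rightarrow> 'm set \<Rightarrow> bool"
  for \<I> G M \<phi> a where
  zero: "is_zero_ord \<alpha> \<Longrightarrow> rank_ge \<I> G M \<phi> a \<alpha> A"
| succ: "is_succ_ord \<alpha> \<beta> \<Longrightarrow> finite B \<Longrightarrow> A \<subseteq> B \<Longrightarrow> B \<subseteq> M \<Longrightarrow> \<not> indep \<I> G \<phi> (set a) A B \<Longrightarrow>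
     rank_ge \<I> G M \<phi> a \<alpha> B \<Longrightarrow> rank_ge \<I> G M \<phi> a \<beta> A"
| limit: "is_limit_ord \<beta> \<Longrightarrow> (\<And>\<alpha>. \<alpha> < \<beta> \<Longrightarrow> rank_ge \<I> G M \<phi> a \<alpha> A) \<Longrightarrow>
     rank_ge \<I> G M \<phi> a \<beta> A"

text \<open>The rank with values in \<open>'o\<close> extended by \<open>Pinf\<close>. The \<open>LEAST\<close> upper bound is the supremum
  in \<open>'o\<close>. If \<open>'o\<close> is too short to contain an ordinal that the rank fails to reach,
  the value is \<open>Pinf\<close>.\<close>

definition perp_rank ::
  "'g ideal_scheme \<Rightarrow> ('g, 'z) monoid_scheme \<Rightarrow> 'm set \<Rightarrow> ('g \<Rightarrow> 'm \<Rightarrow> 'm) \<Rightarrow> 'm list \<Rightarrow>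
   'm set \<Rightarrow> 'o::wellorder extended" where
  "perp_rank \<I> G M \<phi> a A =
     (if \<forall>\<alpha>::'o. rank_ge \<I> G M \<phi> a \<alpha> A then Pinf
      else Fin (LEAST \<beta>. \<forall>\<alpha>. rank_ge \<I> G M \<phi> a \<alpha> A \<longrightarrow> \<alpha> \<le> \<beta>))"

text \<open>The two type arguments are the universe of the structures and the ordinals in which
  ranks are measured.\<close>

definition perp_le ::
  "'m itself \<Rightarrow> 'o::wellorder itself \<Rightarrow> ('g, 'z) monoid_scheme \<Rightarrow> 'g topology \<Rightarrow>
   'g ideal_scheme \<Rightarrow> 'g ideal_scheme \<Rightarrow> bool" where
  "perp_le _ _ G T \<I> \<J> \<longleftrightarrow>
     (\<forall>(M :: 'm set) \<phi> a A.
        G_structure G T M \<phi> \<and> set a \<subseteq> M \<and> finite A \<and> A \<subseteq> M \<longrightarrow>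
        (perp_rank \<I> G M \<phi> a A :: 'o extended) \<le> perp_rank \<J> G M \<phi> a A)"

end

theory Submission
  imports Defs
begin

text \<open>Everything rests on one dichotomy. If \<open>A\<close> and \<open>B\<close> are closed subgroups of a
  \<open>\<sigma>\<close>-compact completely metrizable group \<open>H\<close>, then \<open>AB\<close> is a countable union of compact sets,
  namely of the products of the compact pieces of \<open>A\<close> and \<open>B\<close>. If \<open>AB\<close> is non-meager, one of these
  closed pieces has interior, and multiplying by \<open>A\<close> on the left and by \<open>B\<close> on the right moves an
  interior point to every other point, so \<open>AB\<close> is open. Conversely, Baire's theorem makes the
  nonempty set \<open>AB\<close> non-meager as soon as it is open. The hypotheses on \<open>H\<close> pass to closed
  subgroups, so the dichotomy (\<open>not_meager_iff_open_set_mult\<close>) applies inside every pointwise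
  stabilizer of a structure; this identifies the two independence relations.

  The same dichotomy makes the meager scheme strongly admissible. For transitivity, if \<open>HK\<^sub>3\<close> is open
  then so is \<open>HK\<^sub>2 = HK\<^sub>3K\<^sub>2\<close>, and \<open>(H \<inter> K\<^sub>2)K\<^sub>3\<close> is the trace of \<open>HK\<^sub>3\<close> on \<open>K\<^sub>2\<close>. In the other
  direction, countably many right translates of the open set \<open>(H \<inter> K\<^sub>2)K\<^sub>3\<close> cover \<open>K\<^sub>2\<close> by the
  Lindelof property, hence countably many translates of \<open>HK\<^sub>3\<close> cover the non-meager set \<open>HK\<^sub>2\<close>. The
  dichotomy clause holds because a closed subgroup is non-meager iff it is open iff it has countable index.

  The same covering argument gives maximality. Suppose that \<open>AB\<close> is open in \<open>H\<close> and lies in the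
  ideal at \<open>H\<close> of some strongly admissible scheme. Countably many translates of \<open>AB\<close> cover \<open>H\<close>, so
  \<open>H\<close> itself lies in that ideal, against the dichotomy clause for the trivial quotient \<open>H/H\<close>. So
  \<open>\<perp>\<^sup>n\<^sup>m\<close> implies the independence of the scheme (\<open>indep_nm_imp_indep\<close>), and fewer dependences mean
  smaller ranks.\<close>

section \<open>Meager sets\<close>

lemma nowhere_dense_in_subset:
  assumes "nowhere_dense_in X S" "R \<subseteq> S"
  shows "nowhere_dense_in X R"
proof -
  have "X interior_of (X closure_of R) \<subseteq> X interior_of (X closure_of S)"
    by (intro interior_of_mono closure_of_mono assms)
  then show ?thesis
    using assms by (auto simp: nowhere_dense_in_def)
qed

lemma meager_in_subset:
  assumes "meager_in X S" "R \<subseteq> S"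
  shows "meager_in X R"
proof -
  obtain N :: "nat \<Rightarrow> 'a set" where N: "\<And>n. nowhere_dense_in X (N n)" "S = (\<Union>n. N n)"
    using assms(1) unfolding meager_in_def by blast
  have "\<And>n. nowhere_dense_in X (N n \<inter> R)"
    using N(1) nowhere_dense_in_subset by (metis inf_le1)
  moreover have "R = (\<Union>n. N n \<inter> R)"
    using N(2) assms(2) by blast
  ultimately show ?thesis
    unfolding meager_in_def by (intro exI[of _ "\<lambda>n. N n \<inter> R"]) simp
qed

lemma meager_in_subset_topspace: "meager_in X S \<Longrightarrow> S \<subseteq> topspace X"
  unfolding meager_in_def nowhere_dense_in_def by blast

lemma meager_in_empty: "meager_in X {}"
  unfolding meager_in_def by (intro exI[of _ "\<lambda>n. {}"]) (simp add: nowhere_dense_in_def)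

lemma meager_in_UN_nat:
  fixes S :: "nat \<Rightarrow> 'a set"
  assumes "\<And>n. meager_in X (S n)"
  shows "meager_in X (\<Union>n. S n)"
proof -
  obtain N :: "nat \<Rightarrow> nat \<Rightarrow> 'a set"
    where N: "\<And>n m. nowhere_dense_in X (N n m)" "\<And>n. S n = (\<Union>m. N n m)"
    using assms unfolding meager_in_def by metis
  define P where "P k = N (fst (prod_decode k)) (snd (prod_decode k))" for k
  have "(\<Union>n. S n) = (\<Union>k. P k)"
  proof -
    have "N n m \<subseteq> (\<Union>k. P k)" for n m
      using UN_upper[of "prod_encode (n, m)" UNIV P] by (simp add: P_def)
    then show ?thesis
      by (auto simp: N(2) P_def)
  qed
  moreover have "\<And>k. nowhere_dense_in X (P k)"
    by (simp add: P_def N)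
  ultimately show ?thesis
    unfolding meager_in_def by blast
qed

lemma meager_in_UN_countable:
  assumes "countable D" "\<And>d. d \<in> D \<Longrightarrow> meager_in X (S d)"
  shows "meager_in X (\<Union>d\<in>D. S d)"
proof (cases "D = {}")
  case True
  then show ?thesis by (simp add: meager_in_empty)
next
  case False
  then have "meager_in X (\<Union>n. S (from_nat_into D n))"
    by (intro meager_in_UN_nat assms(2) from_nat_into)
  moreover have "(\<Union>n. S (from_nat_into D n)) = (\<Union>d\<in>D. S d)"
    using range_from_nat_into[OF False assms(1)] by (metis image_image)
  ultimately show ?thesis by simp
qed

lemma sigma_ideal_on_meager_sets: "sigma_ideal_on (topspace X) {S. meager_in X S}"
proof -
  have "meager_in X (R \<union> S)" if "meager_in X R" "meager_in X S" for R S
    using meager_in_UN_countable[of "{R, S}" X "\<lambda>S. S"] that by auto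
  then have "ideal_on (topspace X) {S. meager_in X S}"
    using meager_in_subset meager_in_subset_topspace[of X] meager_in_empty[of X]
    unfolding ideal_on_def by blast
  then show ?thesis
    using meager_in_UN_nat by (auto simp: sigma_ideal_on_def)
qed

lemma meager_in_UN_closedin:
  assumes "\<And>i. i \<in> I \<Longrightarrow> closedin X (F i)" "countable I" "X interior_of (\<Union>i\<in>I. F i) = {}"
  shows "meager_in X (\<Union>i\<in>I. F i)"
proof (rule meager_in_UN_countable[OF assms(2)])
  fix i assume "i \<in> I"
  then have "X interior_of (F i) \<subseteq> X interior_of (\<Union>i\<in>I. F i)"
    by (intro interior_of_mono) blast
  then have "nowhere_dense_in X (F i)"
    using assms(1)[OF \<open>i \<in> I\<close>] assms(3)
    by (simp add: nowhere_dense_in_def closedin_subset closure_of_closedin)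
  then show "meager_in X (F i)"
    unfolding meager_in_def by (intro exI[of _ "\<lambda>n. F i"]) simp
qed

lemma openin_not_meager_in:
  assumes X: "completely_metrizable_space X" and U: "openin X U" "U \<noteq> {}"
  shows "\<not> meager_in X U"
proof
  assume "meager_in X U"
  then obtain N :: "nat \<Rightarrow> 'a set"
    where N: "\<And>n. nowhere_dense_in X (N n)" "U = (\<Union>n. N n)"
    unfolding meager_in_def by blast
  have "X interior_of (\<Union>(range (\<lambda>n. X closure_of (N n)))) = {}"
    using N(1) X by (intro Baire_category_alt) (auto simp: nowhere_dense_in_def)
  moreover have "U \<subseteq> \<Union>(range (\<lambda>n. X closure_of (N n)))"
    using N closure_of_subset unfolding nowhere_dense_in_def by fastforce
  ultimately show False
    using U interior_of_maximal by blast
qed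

lemma meager_in_homeomorphic_map_image:
  assumes "homeomorphic_map X Y f" "meager_in X S"
  shows "meager_in Y (f ` S)"
proof -
  obtain N :: "nat \<Rightarrow> 'a set"
    where N: "\<And>n. nowhere_dense_in X (N n)" "S = (\<Union>n. N n)"
    using assms(2) unfolding meager_in_def by blast
  have "nowhere_dense_in Y (f ` N n)" for n
  proof -
    have sub: "N n \<subseteq> topspace X" "X closure_of N n \<subseteq> topspace X"
      using N(1) by (auto simp: nowhere_dense_in_def closure_of_subset_topspace)
    then show ?thesis
      using N(1)[of n] homeomorphic_map_closure_of[OF assms(1) sub(1)]
        homeomorphic_map_interior_of[OF assms(1) sub(2)] homeomorphic_imp_surjective_map[OF assms(1)]
        image_mono[OF sub(1), of f]
      by (simp add: nowhere_dense_in_def)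
  qed
  moreover have "f ` S = (\<Union>n. f ` N n)"
    using N(2) by blast
  ultimately show ?thesis
    unfolding meager_in_def by (intro exI[of _ "\<lambda>n. f ` N n"]) simp
qed

lemma homeomorphic_maps_meager_sets:
  assumes "homeomorphic_maps X Y f g"
  shows "image f ` {S. meager_in X S} = {S. meager_in Y S}"
proof
  have f: "homeomorphic_map X Y f" and g: "homeomorphic_map Y X g"
    and fg: "\<And>y. y \<in> topspace Y \<Longrightarrow> f (g y) = y"
    using assms by (simp_all add: homeomorphic_maps_map)
  show "image f ` {S. meager_in X S} \<subseteq> {S. meager_in Y S}"
    using meager_in_homeomorphic_map_image[OF f] by blast
  show "{S. meager_in Y S} \<subseteq> image f ` {S. meager_in X S}"
  proof
    fix S assume "S \<in> {S. meager_in Y S}"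
    then have S: "meager_in Y S" by simp
    then have "f ` g ` S = S"
      using fg meager_in_subset_topspace[OF S] by (force simp: image_iff subset_iff)
    then show "S \<in> image f ` {S. meager_in X S}"
      using meager_in_homeomorphic_map_image[OF g S] by (metis CollectI imageI)
  qed
qed

section \<open>Products of closed subgroups\<close>

text \<open>A \<open>\<sigma>\<close>-compact metrizable space is separable, so these are the \<open>\<sigma>\<close>-compact Polish groups. The
  covering arguments use countability in the form of the Lindelof property, an immediate
  consequence of \<open>\<sigma>\<close>-compactness. In this form it is clear that the class is closed under passing
  to closed subgroups, so that facts about the whole group transfer to subgroups.\<close>

locale sigma_compact_group =
  fixes G (structure) and T
  assumes topological_group: "topological_group G T"
    and completely_metrizable: "completely_metrizable_space T"
    and sigma_compact: "sigma_compact_space T"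

sublocale sigma_compact_group \<subseteq> group G
  using topological_group by (simp add: topological_group_def)

context sigma_compact_group
begin

lemma topspace_eq: "topspace T = carrier G"
  using topological_group by (simp add: topological_group_def)

lemma continuous_map_mult:
  assumes "continuous_map X T f" "continuous_map X T g"
  shows "continuous_map X T (\<lambda>x. f x \<otimes> g x)"
proof -
  have "continuous_map X (prod_topology T T) (\<lambda>x. (f x, g x))"
    using assms by (simp add: continuous_map_pairedI)
  from continuous_map_compose[OF this, of T "\<lambda>(x, y). x \<otimes> y"] show ?thesis
    using topological_group by (simp add: topological_group_def o_def)
qed

lemma inv_cancel_left:
  assumes "x \<in> carrier G" "y \<in> carrier G"
  shows "inv x \<otimes> (x \<otimes> y) = y" "x \<otimes> (inv x \<otimes> y) = y"
  using assms by (simp_all flip: m_assoc)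

lemma one_in_set_mult:
  assumes "subgroup A G" "subgroup B G"
  shows "\<one> \<in> A <#> B"
proof -
  have "\<one> \<otimes> \<one> \<in> A <#> B"
    using assms unfolding set_mult_def by (blast intro: subgroup.one_closed)
  then show ?thesis by simp
qed

lemma homeomorphic_maps_translations:
  assumes "g \<in> carrier G" "h \<in> carrier G"
  shows "homeomorphic_maps T T (\<lambda>x. g \<otimes> x \<otimes> h) (\<lambda>x. inv g \<otimes> x \<otimes> inv h)"
  unfolding homeomorphic_maps_def
proof (intro conjI ballI)
  show "continuous_map T T (\<lambda>x. g \<otimes> x \<otimes> h)" "continuous_map T T (\<lambda>x. inv g \<otimes> x \<otimes> inv h)"
    using assms
    by (intro continuous_map_mult continuous_map_const[THEN iffD2] continuous_map_id[unfolded id_def];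
        simp add: topspace_eq)+
  show "inv g \<otimes> (g \<otimes> x \<otimes> h) \<otimes> inv h = x" if "x \<in> topspace T" for x
    using assms that by (simp add: topspace_eq m_assoc inv_cancel_left)
  show "g \<otimes> (inv g \<otimes> x \<otimes> inv h) \<otimes> h = x" if "x \<in> topspace T" for x
    using assms that by (simp add: topspace_eq m_assoc inv_cancel_left)
qed

lemma homeomorphic_map_translations:
  assumes "g \<in> carrier G" "h \<in> carrier G"
  shows "homeomorphic_map T T (\<lambda>x. g \<otimes> x \<otimes> h)"
  using homeomorphic_maps_translations[OF assms] by (rule homeomorphic_maps_imp_map)

lemma homeomorphic_map_left_translation:
  assumes "g \<in> carrier G"
  shows "homeomorphic_map T T ((\<otimes>) g)"
  by (rule homeomorphic_map_eq[OF homeomorphic_map_translations[OF assms one_closed]])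
    (simp add: assms topspace_eq)

lemma homeomorphic_map_right_translation:
  assumes "g \<in> carrier G"
  shows "homeomorphic_map T T (\<lambda>x. x \<otimes> g)"
  by (rule homeomorphic_map_eq[OF homeomorphic_map_translations[OF one_closed assms]])
    (simp add: assms topspace_eq)

lemma meager_in_l_coset:
  assumes "meager_in T X" "g \<in> carrier G"
  shows "meager_in T (g <# X)"
  using meager_in_homeomorphic_map_image[OF homeomorphic_map_left_translation[OF assms(2)] assms(1)]
  by (simp add: l_coset_def UNION_singleton_eq_range)

lemma meager_in_r_coset:
  assumes "meager_in T X" "g \<in> carrier G"
  shows "meager_in T (X #> g)"
  using meager_in_homeomorphic_map_image[OF homeomorphic_map_right_translation[OF assms(2)] assms(1)]
  by (simp add: r_coset_def UNION_singleton_eq_range)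

lemma openin_r_coset:
  assumes "openin T U" "g \<in> carrier G"
  shows "openin T (U #> g)"
proof -
  have "openin T ((\<lambda>x. x \<otimes> g) ` U)"
    using homeomorphic_map_openness_eq[OF homeomorphic_map_right_translation[OF assms(2)]] assms(1)
    by blast
  then show ?thesis by (simp add: r_coset_def UNION_singleton_eq_range)
qed

lemma openin_set_mult:
  assumes "openin T U" "V \<subseteq> carrier G"
  shows "openin T (U <#> V)"
proof -
  have "U <#> V = (\<Union>v\<in>V. U #> v)"
    by (auto simp: set_mult_def r_coset_def)
  then show ?thesis
    using assms openin_r_coset by (auto intro!: openin_Union)
qed

lemma closed_subgroup_sigma_compact_group:
  assumes "closed_subgroup G T H"
  shows "sigma_compact_group (G\<lparr>carrier := H\<rparr>) (subtopology T H)"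
proof
  have H: "subgroup H G" "closedin T H" and sub: "H \<subseteq> carrier G"
    using assms subgroup.subset by (auto simp: closed_subgroup_def)
  then have top: "topspace (subtopology T H) = H"
    using topspace_eq by (simp add: Int_absorb1)
  show "topological_group (G\<lparr>carrier := H\<rparr>) (subtopology T H)"
    unfolding topological_group_def
  proof (intro conjI)
    show "group (G\<lparr>carrier := H\<rparr>)"
      by (rule subgroup_imp_group[OF H(1)])
    have "continuous_map (subtopology (prod_topology T T) (H \<times> H)) T (\<lambda>(x, y). x \<otimes> y)"
      using topological_group continuous_map_from_subtopology by (auto simp: topological_group_def)
    then show "continuous_map (prod_topology (subtopology T H) (subtopology T H)) (subtopology T H)
        (\<lambda>(x, y). x \<otimes>\<^bsub>G\<lparr>carrier := H\<rparr>\<^esub> y)"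
      using H(1) by (auto simp: continuous_map_in_subtopology subtopology_Times subgroup.m_closed)
    have "continuous_map (subtopology T H) (subtopology T H) (\<lambda>x. inv x)"
      using topological_group continuous_map_from_subtopology H(1)
      by (auto simp: topological_group_def continuous_map_in_subtopology subgroup.m_inv_closed)
    then show "continuous_map (subtopology T H) (subtopology T H) (\<lambda>x. inv\<^bsub>G\<lparr>carrier := H\<rparr>\<^esub> x)"
      by (rule continuous_map_eq) (simp add: H(1) top)
  qed (use top in simp)
  show "completely_metrizable_space (subtopology T H)"
    by (rule completely_metrizable_space_closedin[OF completely_metrizable H(2)])
  obtain K :: "nat \<Rightarrow> 'a set" where K: "\<And>n. compactin T (K n)" "topspace T = (\<Union>n. K n)"
    using sigma_compact unfolding sigma_compact_space_def by blast
  have "\<And>n. compactin (subtopology T H) (K n \<inter> H)"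
    using K(1) H(2) by (simp add: compactin_subtopology compact_Int_closedin)
  moreover have "topspace (subtopology T H) = (\<Union>n. K n \<inter> H)"
    using K(2) by auto
  ultimately show "sigma_compact_space (subtopology T H)"
    unfolding sigma_compact_space_def by (intro exI[of _ "\<lambda>n. K n \<inter> H"]) simp
qed

lemma closed_subgroup_relative:
  assumes "closed_subgroup G T H" "closed_subgroup G T A" "A \<subseteq> H"
  shows "closed_subgroup (G\<lparr>carrier := H\<rparr>) (subtopology T H) A"
  using assms by (auto simp: closed_subgroup_def subgroup_incl closedin_subset_topspace)

lemma Lindelof_space: "Lindelof_space T"
proof -
  obtain K :: "nat \<Rightarrow> 'a set" where K: "\<And>n. compactin T (K n)" "topspace T = (\<Union>n. K n)"
    using sigma_compact unfolding sigma_compact_space_def by blast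
  have "Lindelof_space (subtopology T (\<Union>(range K)))"
    using K(1) by (intro Lindelof_space_Union) (auto simp: compactin_subspace compact_imp_Lindelof_space)
  then show ?thesis
    using K(2) by (metis subtopology_topspace)
qed

lemma countable_cover_by_r_cosets:
  assumes U: "openin T U" "U \<noteq> {}"
  obtains D where "countable D" "D \<subseteq> carrier G" "carrier G = (\<Union>d\<in>D. U #> d)"
proof -
  obtain u where u: "u \<in> U" using U(2) by blast
  have sub: "U \<subseteq> carrier G"
    using U(1) openin_subset topspace_eq by blast
  have in_coset: "x \<in> U #> (inv u \<otimes> x)" if "x \<in> carrier G" for x
  proof -
    have "x = u \<otimes> (inv u \<otimes> x)"
      using u sub that by (simp add: subset_iff flip: m_assoc)
    then show ?thesis
      using u by (auto simp: r_coset_def)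
  qed
  have "\<Union>((#>) U ` carrier G) = topspace T"
  proof
    show "\<Union>((#>) U ` carrier G) \<subseteq> topspace T"
      using r_coset_subset_G[OF sub] topspace_eq by blast
    show "topspace T \<subseteq> \<Union>((#>) U ` carrier G)"
    proof
      fix x assume "x \<in> topspace T"
      then have "x \<in> carrier G" "inv u \<otimes> x \<in> carrier G"
        using u sub by (auto simp: topspace_eq)
      then show "x \<in> \<Union>((#>) U ` carrier G)"
        using in_coset by (intro UN_I)
    qed
  qed
  moreover have "\<forall>V \<in> (#>) U ` carrier G. openin T V"
    using openin_r_coset[OF U(1)] by auto
  ultimately obtain \<V> where \<V>: "countable \<V>" "\<V> \<subseteq> (#>) U ` carrier G" "\<Union>\<V> = topspace T"
    using Lindelof_space unfolding Lindelof_space_def by meson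
  then obtain D where "countable D" "D \<subseteq> carrier G" "\<V> = (#>) U ` D"
    using countable_subset_image by metis
  then show thesis
    using that \<V>(3) topspace_eq by simp
qed

lemma countable_cover_by_r_cosets_relative:
  assumes "closed_subgroup G T H" "openin (subtopology T H) U" "U \<noteq> {}"
  obtains D where "countable D" "D \<subseteq> H" "H = (\<Union>d\<in>D. U #> d)"
proof -
  interpret H: sigma_compact_group "G\<lparr>carrier := H\<rparr>" "subtopology T H"
    by (rule closed_subgroup_sigma_compact_group[OF assms(1)])
  obtain D where "countable D" "D \<subseteq> carrier (G\<lparr>carrier := H\<rparr>)"
    "carrier (G\<lparr>carrier := H\<rparr>) = (\<Union>d\<in>D. U #>\<^bsub>G\<lparr>carrier := H\<rparr>\<^esub> d)"
    using H.countable_cover_by_r_cosets[OF assms(2,3)] .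
  then show thesis
    using that[of D] by (simp add: r_coset_def)
qed

text \<open>Products of two compact pieces are compact, hence closed, so \<open>AB\<close> is an \<open>F\<^sub>\<sigma>\<close> set. Without
  interior it would be a countable union of closed sets without interior.\<close>

lemma set_mult_interior_nonempty:
  assumes A: "closedin T A" and B: "closedin T B" and nm: "\<not> meager_in T (A <#> B)"
  shows "T interior_of (A <#> B) \<noteq> {}"
proof
  assume empty: "T interior_of (A <#> B) = {}"
  obtain K :: "nat \<Rightarrow> 'a set" where K: "\<And>n. compactin T (K n)" "topspace T = (\<Union>n. K n)"
    using sigma_compact unfolding sigma_compact_space_def by blast
  define F where "F = (\<lambda>(m, n). (K m \<inter> A) <#> (K n \<inter> B))"
  have closed: "closedin T (F i)" for i
  proof -
    obtain m n where i: "i = (m, n)" by fastforce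
    have "compactin (prod_topology T T) ((K m \<inter> A) \<times> (K n \<inter> B))"
      using K(1) A B by (simp add: compactin_Times compact_Int_closedin)
    then have "compactin T ((\<lambda>(x, y). x \<otimes> y) ` ((K m \<inter> A) \<times> (K n \<inter> B)))"
      using topological_group by (auto simp: topological_group_def intro: image_compactin)
    moreover have "(\<lambda>(x, y). x \<otimes> y) ` ((K m \<inter> A) \<times> (K n \<inter> B)) = F i"
      by (force simp: F_def i set_mult_def)
    ultimately show ?thesis
      using completely_metrizable completely_metrizable_imp_metrizable_space compactin_imp_closedin
        metrizable_imp_Hausdorff_space by fastforce
  qed
  have "A <#> B = (\<Union>i. F i)"
  proof
    show "A <#> B \<subseteq> (\<Union>i. F i)"
    proof
      fix x assume "x \<in> A <#> B"
      then obtain a b where ab: "a \<in> A" "b \<in> B" "x = a \<otimes> b"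
        by (auto simp: set_mult_def)
      then have "a \<in> (\<Union>n. K n)" "b \<in> (\<Union>n. K n)"
        using closedin_subset[OF A] closedin_subset[OF B] K(2) by auto
      then obtain m n where "a \<in> K m" "b \<in> K n"
        by blast
      with ab have "x \<in> F (m, n)"
        by (auto simp: F_def set_mult_def)
      then show "x \<in> (\<Union>i. F i)" by blast
    qed
    show "(\<Union>i. F i) \<subseteq> A <#> B"
      by (auto simp: F_def set_mult_def)
  qed
  then show False
    using meager_in_UN_closedin[of UNIV T F] closed empty nm by simp
qed

text \<open>One interior point suffices, since left translations by \<open>A\<close> and right translations by \<open>B\<close>
  together act transitively on \<open>AB\<close>.\<close>

lemma openin_set_mult_subgroups:
  assumes A: "subgroup A G" and B: "subgroup B G" and int: "T interior_of (A <#> B) \<noteq> {}"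
  shows "openin T (A <#> B)"
proof (subst openin_subopen, intro ballI)
  fix x assume "x \<in> A <#> B"
  then obtain a b where x: "a \<in> A" "b \<in> B" "x = a \<otimes> b"
    by (auto simp: set_mult_def)
  define U where "U = T interior_of (A <#> B)"
  have U: "openin T U" "U \<subseteq> A <#> B"
    by (simp_all add: U_def interior_of_subset)
  then obtain a0 b0 where x0: "a0 \<in> A" "b0 \<in> B" "a0 \<otimes> b0 \<in> U"
    using int by (fastforce simp: U_def set_mult_def)
  have carr: "A \<subseteq> carrier G" "B \<subseteq> carrier G"
    using A B subgroup.subset by blast+
  \<comment> \<open>The two-sided translation that moves the interior point \<open>a0 \<otimes> b0\<close> to \<open>a \<otimes> b\<close> preserves
    the product \<open>AB\<close>.\<close>
  define g h where "g = a \<otimes> inv a0" and "h = inv b0 \<otimes> b"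
  have gh: "g \<in> A" "h \<in> B"
    using x x0 A B by (auto simp: g_def h_def subgroup.m_closed subgroup.m_inv_closed)
  define V where "V = (\<lambda>y. g \<otimes> y \<otimes> h) ` U"
  have "openin T V"
    using homeomorphic_map_openness_eq[OF homeomorphic_map_translations] gh carr U(1)
    unfolding V_def by blast
  moreover have "x \<in> V"
  proof -
    have "g \<otimes> (a0 \<otimes> b0) \<otimes> h = x"
      unfolding g_def h_def using x x0 carr by (simp add: m_assoc subset_iff inv_cancel_left)
    then show ?thesis
      using x0(3) unfolding V_def by blast
  qed
  moreover have "V \<subseteq> A <#> B"
  proof
    fix v assume "v \<in> V"
    then obtain c d where v: "c \<in> A" "d \<in> B" "v = g \<otimes> (c \<otimes> d) \<otimes> h"
      using U(2) by (auto simp: V_def set_mult_def)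
    then have "v = (g \<otimes> c) \<otimes> (d \<otimes> h)"
      using gh carr by (simp add: m_assoc subset_iff)
    then show "v \<in> A <#> B"
      using v gh A B by (auto simp: set_mult_def intro: subgroup.m_closed)
  qed
  ultimately show "\<exists>V. openin T V \<and> x \<in> V \<and> V \<subseteq> A <#> B"
    by blast
qed

lemma not_meager_iff_open_set_mult:
  assumes "closed_subgroup G T A" "closed_subgroup G T B"
  shows "\<not> meager_in T (A <#> B) \<longleftrightarrow> openin T (A <#> B)"
proof
  have AB: "subgroup A G" "closedin T A" "subgroup B G" "closedin T B"
    using assms by (auto simp: closed_subgroup_def)
  show "openin T (A <#> B)" if "\<not> meager_in T (A <#> B)"
    using openin_set_mult_subgroups[OF AB(1,3) set_mult_interior_nonempty[OF AB(2,4) that]] .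
  show "\<not> meager_in T (A <#> B)" if "openin T (A <#> B)"
    using openin_not_meager_in[OF completely_metrizable that] one_in_set_mult[OF AB(1,3)] by blast
qed

lemma not_meager_iff_open_set_mult_relative:
  assumes H: "closed_subgroup G T H"
    and AB: "closed_subgroup G T A" "closed_subgroup G T B" "A \<subseteq> H" "B \<subseteq> H"
  shows "\<not> meager_in (subtopology T H) (A <#> B) \<longleftrightarrow> openin (subtopology T H) (A <#> B)"
  using sigma_compact_group.not_meager_iff_open_set_mult[OF closed_subgroup_sigma_compact_group[OF H]]
    closed_subgroup_relative[OF H] AB
  by (simp add: set_mult_def)

section \<open>Strong admissibility of the meager scheme\<close>

text \<open>The transitivity clause with the ambient group in the place of \<open>K\<^sub>1\<close>. From left to right, the
  Lindelof property of \<open>K\<^sub>2\<close> reduces \<open>HK\<^sub>2\<close> to countably many translates of \<open>HK\<^sub>3\<close>; from right to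
  left, openness is inherited by \<open>HK\<^sub>2\<close> and by the trace of \<open>HK\<^sub>3\<close> on \<open>K\<^sub>2\<close>.\<close>

lemma not_meager_set_mult_transitive:
  assumes K2: "closed_subgroup G T K2" and K3: "closed_subgroup G T K3"
    and H: "closed_subgroup G T H" and "K3 \<subseteq> K2"
  shows "\<not> meager_in (subtopology T K2) ((H \<inter> K2) <#> K3) \<and> \<not> meager_in T (H <#> K2)
    \<longleftrightarrow> \<not> meager_in T (H <#> K3)"
proof
  have sg: "subgroup K2 G" "subgroup K3 G" "subgroup H G"
    and carr: "K2 \<subseteq> carrier G" "K3 \<subseteq> carrier G" "H \<subseteq> carrier G"
    using K2 K3 H subgroup.subset by (auto simp: closed_subgroup_def)
  have "closed_subgroup G T (H \<inter> K2)"
    using H K2 by (auto simp: closed_subgroup_def subgroups_Inter_pair)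
  then have open_iff: "\<not> meager_in (subtopology T K2) ((H \<inter> K2) <#> K3)
      \<longleftrightarrow> openin (subtopology T K2) ((H \<inter> K2) <#> K3)"
    using K2 K3 \<open>K3 \<subseteq> K2\<close> by (intro not_meager_iff_open_set_mult_relative) auto
  {
    assume nm: "\<not> meager_in (subtopology T K2) ((H \<inter> K2) <#> K3) \<and> \<not> meager_in T (H <#> K2)"
    have "(H \<inter> K2) <#> K3 \<noteq> {}"
      using one_in_set_mult sg subgroups_Inter_pair by blast
    then obtain D where D: "countable D" "D \<subseteq> K2" "K2 = (\<Union>d\<in>D. ((H \<inter> K2) <#> K3) #> d)"
      using countable_cover_by_r_cosets_relative[OF K2] nm open_iff by metis
    have "H <#> K2 \<subseteq> (\<Union>d\<in>D. (H <#> K3) #> d)"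
    proof
      fix x assume "x \<in> H <#> K2"
      then obtain h k where hk: "h \<in> H" "k \<in> K2" "x = h \<otimes> k"
        by (auto simp: set_mult_def)
      from equalityD1[OF D(3)] hk(2) have "k \<in> (\<Union>d\<in>D. ((H \<inter> K2) <#> K3) #> d)"
        by (rule subsetD)
      then obtain d h' k' where d: "d \<in> D" "h' \<in> H" "k' \<in> K3" "k = h' \<otimes> k' \<otimes> d"
        by (auto simp: set_mult_def r_coset_def)
      have "x = (h \<otimes> h') \<otimes> k' \<otimes> d"
        using hk d D(2) carr by (simp add: m_assoc subset_iff)
      moreover have "h \<otimes> h' \<in> H"
        using hk d sg by (simp add: subgroup.m_closed)
      ultimately show "x \<in> (\<Union>d\<in>D. (H <#> K3) #> d)"
        using d by (auto simp: set_mult_def r_coset_def)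
    qed
    moreover have "meager_in T (\<Union>d\<in>D. (H <#> K3) #> d)" if "meager_in T (H <#> K3)"
      using D carr that by (intro meager_in_UN_countable meager_in_r_coset) auto
    ultimately show "\<not> meager_in T (H <#> K3)"
      using nm meager_in_subset by blast
  next
    assume "\<not> meager_in T (H <#> K3)"
    then have op: "openin T (H <#> K3)"
      using not_meager_iff_open_set_mult[OF H K3] by simp
    have "K3 <#> K2 = K2"
    proof
      show "K3 <#> K2 \<subseteq> K2"
        using \<open>K3 \<subseteq> K2\<close> sg by (auto simp: set_mult_def subset_iff intro: subgroup.m_closed)
      have "k = \<one> \<otimes> k" if "k \<in> K2" for k
        using that carr by auto
      then show "K2 \<subseteq> K3 <#> K2"
        using sg(2) unfolding set_mult_def by (blast intro: subgroup.one_closed)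
    qed
    then have "H <#> K2 = (H <#> K3) <#> K2"
      using carr by (simp add: set_mult_assoc)
    then have "openin T (H <#> K2)"
      using openin_set_mult[OF op carr(1)] by simp
    moreover
    \<comment> \<open>Dedekind's modular law for the product set \<open>HK\<^sub>3\<close>.\<close>
    have "(H \<inter> K2) <#> K3 = (H <#> K3) \<inter> K2"
    proof
      show "(H \<inter> K2) <#> K3 \<subseteq> (H <#> K3) \<inter> K2"
        using \<open>K3 \<subseteq> K2\<close> sg by (auto simp: set_mult_def subset_iff intro: subgroup.m_closed)
      show "(H <#> K3) \<inter> K2 \<subseteq> (H \<inter> K2) <#> K3"
      proof
        fix x assume "x \<in> (H <#> K3) \<inter> K2"
        then obtain h k where hk: "h \<in> H" "k \<in> K3" "x = h \<otimes> k" "x \<in> K2"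
          by (auto simp: set_mult_def)
        have "h = x \<otimes> inv k"
          using hk carr by (simp add: m_assoc subset_iff)
        moreover have "x \<otimes> inv k \<in> K2"
          using hk sg(1) \<open>K3 \<subseteq> K2\<close> by (blast intro: subgroup.m_closed subgroup.m_inv_closed)
        ultimately have "h \<in> K2" by simp
        with hk show "x \<in> (H \<inter> K2) <#> K3" by (auto simp: set_mult_def)
      qed
    qed
    then have "openin (subtopology T K2) ((H \<inter> K2) <#> K3)"
      using op by (simp add: openin_subtopology_Int)
    ultimately show "\<not> meager_in (subtopology T K2) ((H \<inter> K2) <#> K3) \<and> \<not> meager_in T (H <#> K2)"
      using open_iff not_meager_iff_open_set_mult[OF H K2] by simp
  }
qed

text \<open>If \<open>K\<close> has countable index and is meager, then the whole group is meager, against Baire's theorem.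
  If \<open>K = KK\<close> is non-meager, then it is open, and a cover by cosets of an open subgroup has a
  countable subcover. Right cosets occur in that cover; inversion turns them into left cosets.\<close>

lemma meager_closed_subgroup_iff:
  assumes K: "closed_subgroup G T K"
  shows "meager_in T K \<longleftrightarrow> uncountable (lcosets K)"
proof
  have sg: "subgroup K G" and carr: "K \<subseteq> carrier G"
    using K subgroup.subset by (auto simp: closed_subgroup_def)
  show "uncountable (lcosets K)" if "meager_in T K"
  proof
    assume "countable (lcosets K)"
    then have "meager_in T (\<Union>X\<in>lcosets K. X)"
      using that by (intro meager_in_UN_countable) (auto simp: LCOSETS_def meager_in_l_coset)
    moreover have "carrier G \<subseteq> (\<Union>X\<in>lcosets K. X)"
      using lcos_self[OF _ sg] by (auto simp: LCOSETS_def)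
    ultimately have "meager_in T (carrier G)"
      using meager_in_subset by blast
    then show False
      using openin_not_meager_in[OF completely_metrizable openin_topspace] one_closed
      by (auto simp: topspace_eq)
  qed
  show "meager_in T K" if "uncountable (lcosets K)"
  proof (rule ccontr)
    assume "\<not> meager_in T K"
    moreover have "K <#> K = K"
      by (rule subgroup_mult_id[OF sg])
    ultimately have "openin T K"
      using not_meager_iff_open_set_mult[OF K K] by simp
    then obtain D where D: "countable D" "D \<subseteq> carrier G" "carrier G = (\<Union>d\<in>D. K #> d)"
      using countable_cover_by_r_cosets subgroup.one_closed[OF sg] by blast
    have "lcosets K \<subseteq> (\<lambda>d. inv d <# K) ` D"
    proof
      fix X assume "X \<in> lcosets K"
      then obtain g where g: "g \<in> carrier G" "X = g <# K"
        by (auto simp: LCOSETS_def)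
      then have "inv g \<in> (\<Union>d\<in>D. K #> d)"
        using D(3) by (metis inv_closed)
      then obtain d k where d: "d \<in> D" "k \<in> K" "inv g = k \<otimes> d"
        by (auto simp: r_coset_def)
      then have "g = inv d \<otimes> inv k"
        using g D(2) carr by (metis inv_inv inv_mult_group subsetD)
      then have "g \<in> inv d <# K"
        using d sg by (auto simp: l_coset_def subgroup.m_inv_closed)
      then have "X = inv d <# K"
        using g d D(2) sg l_repr_independence by (metis inv_closed subsetD)
      then show "X \<in> (\<lambda>d. inv d <# K) ` D"
        using d by blast
    qed
    then show False
      using that D(1) by (meson countable_image countable_subset)
  qed
qed

lemma topspace_closed_subgroup: "closed_subgroup G T H \<Longrightarrow> topspace (subtopology T H) = H"
  using subgroup.subset by (auto simp: closed_subgroup_def topspace_eq)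

lemma scheme_sigma_meager: "scheme_sigma G T (meager_scheme T)"
  unfolding scheme_sigma_def meager_scheme_def
  by (metis sigma_ideal_on_meager_sets topspace_closed_subgroup)

lemma scheme_invariant_meager: "scheme_invariant G T (meager_scheme T)"
  unfolding scheme_invariant_def
proof (intro conjI allI impI ballI)
  fix H h X
  assume H: "closed_subgroup G T H" and h: "h \<in> H" and X: "X \<in> meager_scheme T H"
  interpret H: sigma_compact_group "G\<lparr>carrier := H\<rparr>" "subtopology T H"
    by (rule closed_subgroup_sigma_compact_group[OF H])
  have "h <#\<^bsub>G\<lparr>carrier := H\<rparr>\<^esub> X = h <# X" "X #>\<^bsub>G\<lparr>carrier := H\<rparr>\<^esub> h = X #> h"
    by (simp_all add: l_coset_def r_coset_def)
  then show "h <# X \<in> meager_scheme T H" "X #> h \<in> meager_scheme T H"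
    using H.meager_in_l_coset[of X h] H.meager_in_r_coset[of X h] h X
    by (simp_all add: meager_scheme_def)
next
  fix H g
  assume H: "closed_subgroup G T H" and g: "g \<in> carrier G"
  have "H \<subseteq> carrier G"
    using H subgroup.subset by (auto simp: closed_subgroup_def)
  define f where "f = (\<lambda>x. inv g \<otimes> x \<otimes> g)"
  have "homeomorphic_maps T T f (\<lambda>x. inv (inv g) \<otimes> x \<otimes> inv g)"
    unfolding f_def using g by (intro homeomorphic_maps_translations) auto
  moreover have "f ` (topspace T \<inter> H) = topspace T \<inter> f ` H"
  proof -
    have "f ` H \<subseteq> topspace T" "H \<subseteq> topspace T"
      using \<open>H \<subseteq> carrier G\<close> g by (auto simp: topspace_eq f_def)
    then show ?thesis by (simp add: Int_absorb1)
  qed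
  ultimately have hom: "homeomorphic_maps (subtopology T H) (subtopology T (f ` H)) f
      (\<lambda>x. inv (inv g) \<otimes> x \<otimes> inv g)"
    by (rule homeomorphic_maps_subtopologies)
  have "conj_set G g = image f"
    by (simp add: fun_eq_iff conj_set_def f_def)
  then show "conj_set G g ` meager_scheme T H = meager_scheme T (conj_set G g H)"
    using homeomorphic_maps_meager_sets[OF hom] by (simp only: meager_scheme_def)
qed

lemma scheme_transitive_meager: "scheme_transitive G T (meager_scheme T)"
  unfolding scheme_transitive_def
proof (intro allI impI, elim conjE)
  fix K1 K2 K3 H
  assume K1: "closed_subgroup G T K1" and K: "closed_subgroup G T K2" "closed_subgroup G T K3"
    "closed_subgroup G T H" and sub: "K3 \<subseteq> K2" "K2 \<subseteq> K1" "H \<subseteq> K1"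
  have set_mult_eq: "A <#>\<^bsub>G\<lparr>carrier := K1\<rparr>\<^esub> B = A <#> B" for A B
    by (simp add: set_mult_def)
  have "subtopology (subtopology T K1) K2 = subtopology T K2"
    using sub by (simp add: subtopology_subtopology inf_absorb2)
  then show "((H \<inter> K2) <#> K3 \<notin> meager_scheme T K2 \<and> H <#> K2 \<notin> meager_scheme T K1)
      = (H <#> K3 \<notin> meager_scheme T K1)"
    using sigma_compact_group.not_meager_set_mult_transitive[OF
        closed_subgroup_sigma_compact_group[OF K1] closed_subgroup_relative[OF K1 K(1) sub(2)]
        closed_subgroup_relative[OF K1 K(2) subset_trans[OF sub(1,2)]]
        closed_subgroup_relative[OF K1 K(3) sub(3)] sub(1)]
    by (simp only: meager_scheme_def set_mult_eq mem_Collect_eq)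
qed

lemma scheme_dichotomy_meager: "scheme_dichotomy G T (meager_scheme T)"
  unfolding scheme_dichotomy_def meager_scheme_def mem_Collect_eq
proof (intro allI impI, elim conjE)
  fix K H
  assume K: "closed_subgroup G T K" and H: "closed_subgroup G T H" and "K \<subseteq> H"
  show "meager_in (subtopology T H) K \<longleftrightarrow> uncountable (lcosets\<^bsub>G\<lparr>carrier := H\<rparr>\<^esub> K)"
    by (rule sigma_compact_group.meager_closed_subgroup_iff[OF
          closed_subgroup_sigma_compact_group[OF H] closed_subgroup_relative[OF H K \<open>K \<subseteq> H\<close>]])
qed

lemma strongly_admissible_meager_scheme: "strongly_admissible G T (meager_scheme T)"
  using scheme_sigma_meager scheme_invariant_meager scheme_transitive_meager scheme_dichotomy_meager
  unfolding strongly_admissible_def is_ideal_scheme_def scheme_sigma_def sigma_ideal_on_def by blast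

section \<open>Comparison of independence relations\<close>

lemma closed_subgroup_pointwise_stabilizer:
  assumes M: "G_structure G T M \<phi>" and A: "A \<subseteq> M"
  shows "closed_subgroup G T (pointwise_stabilizer G \<phi> A)"
proof -
  interpret group_action G M \<phi>
    using M by (simp add: G_structure_def)
  let ?S = "insert (carrier G) (stabilizer G \<phi> ` A)"
  \<comment> \<open>Inserting the whole group keeps the family nonempty when \<open>A\<close> is empty.\<close>
  have eq: "pointwise_stabilizer G \<phi> A = \<Inter>?S"
    by (auto simp: pointwise_stabilizer_def stabilizer_def)
  have "subgroup (\<Inter>?S) G"
    using A stabilizer_subgroup subgroup_self by (intro subgroups_Inter) auto
  moreover have "closedin T (\<Inter>?S)"
    using A M closedin_topspace[of T] by (intro closedin_Inter) (auto simp: G_structure_def topspace_eq)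
  ultimately show ?thesis
    by (simp add: closed_subgroup_def eq)
qed

lemma pointwise_stabilizer_antimono:
  "A \<subseteq> B \<Longrightarrow> pointwise_stabilizer G \<phi> B \<subseteq> pointwise_stabilizer G \<phi> A"
  by (auto simp: pointwise_stabilizer_def)

lemma indep_nm_iff_indep_o:
  assumes M: "G_structure G T M \<phi>" and "a \<subseteq> M" "b \<subseteq> M" "C \<subseteq> M"
  shows "indep_nm G T \<phi> a C b \<longleftrightarrow> indep_o G T \<phi> a C b"
  unfolding indep_nm_def indep_o_def stab_product_def
  using assms
  by (intro not_meager_iff_open_set_mult_relative closed_subgroup_pointwise_stabilizer[OF M]
      pointwise_stabilizer_antimono) auto

text \<open>Otherwise countably many translates of \<open>U\<close> would put \<open>H\<close> itself into the ideal, although \<open>H/H\<close>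
  has a single element.\<close>

lemma openin_not_in_strongly_admissible:
  assumes I: "strongly_admissible G T \<I>" and H: "closed_subgroup G T H"
    and U: "openin (subtopology T H) U" "U \<noteq> {}"
  shows "U \<notin> \<I> H"
proof
  assume "U \<in> \<I> H"
  interpret H: sigma_compact_group "G\<lparr>carrier := H\<rparr>" "subtopology T H"
    by (rule closed_subgroup_sigma_compact_group[OF H])
  obtain D where D: "countable D" "D \<subseteq> H" "H = (\<Union>d\<in>D. U #> d)"
    using countable_cover_by_r_cosets_relative[OF H U] .
  then have "D \<noteq> {}"
    using U openin_subset by fastforce
  have "\<And>d. d \<in> D \<Longrightarrow> U #> d \<in> \<I> H"
    using I H \<open>U \<in> \<I> H\<close> D(2) unfolding strongly_admissible_def scheme_invariant_def by blast
  then have "\<forall>n. U #> from_nat_into D n \<in> \<I> H"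
    using from_nat_into[OF \<open>D \<noteq> {}\<close>] by simp
  moreover have "sigma_ideal_on H (\<I> H)"
    using I H by (simp add: strongly_admissible_def scheme_sigma_def)
  ultimately have "(\<Union>n. U #> from_nat_into D n) \<in> \<I> H"
    by (simp add: sigma_ideal_on_def)
  moreover have "(\<Union>n. U #> from_nat_into D n) = (\<Union>d\<in>D. U #> d)"
    using range_from_nat_into[OF \<open>D \<noteq> {}\<close> D(1)] by (metis image_image)
  ultimately have "H \<in> \<I> H"
    by (subst D(3)) simp
  then have "uncountable (lcosets\<^bsub>G\<lparr>carrier := H\<rparr>\<^esub> H)"
    using I H by (simp add: strongly_admissible_def scheme_dichotomy_def)
  moreover have "lcosets\<^bsub>G\<lparr>carrier := H\<rparr>\<^esub> H \<subseteq> {H}"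
    using H.coset_join3[OF _ H.subgroup_self] by (auto simp: LCOSETS_def)
  ultimately show False
    by (meson countable_empty countable_insert countable_subset)
qed

lemma indep_nm_imp_indep:
  assumes I: "strongly_admissible G T \<I>"
    and M: "G_structure G T M \<phi>" and sub: "a \<subseteq> M" "b \<subseteq> M" "C \<subseteq> M"
    and nm: "indep_nm G T \<phi> a C b"
  shows "indep \<I> G \<phi> a C b"
proof -
  have "openin (subtopology T (pointwise_stabilizer G \<phi> C)) (stab_product G \<phi> a C b)"
    using nm indep_nm_iff_indep_o[OF M sub] by (simp add: indep_o_def)
  moreover have "stab_product G \<phi> a C b \<noteq> {}"
    using nm by (auto simp: indep_nm_def meager_in_empty)
  ultimately show ?thesis
    unfolding indep_def
    by (rule openin_not_in_strongly_admissible[OF I closed_subgroup_pointwise_stabilizer[OF M sub(3)]])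
qed

end

section \<open>Comparison of ranks\<close>

lemma rank_ge_mono_scheme:
  assumes "rank_ge \<I> G M \<phi> a \<alpha> A" "A \<subseteq> M"
    and "\<And>C B. C \<subseteq> M \<Longrightarrow> B \<subseteq> M \<Longrightarrow> indep \<J> G \<phi> (set a) C B \<Longrightarrow> indep \<I> G \<phi> (set a) C B"
  shows "rank_ge \<J> G M \<phi> a \<alpha> A"
  using assms(1,2)
proof (induction rule: rank_ge.induct)
  case (succ \<alpha> \<beta> B A)
  then show ?case
    using assms(3) by (meson rank_ge.succ)
qed (auto intro: rank_ge.zero rank_ge.limit)

text \<open>The clauses of the rank relate only consecutive ordinals or a limit to all its predecessors, so
  that the ordinals below the rank form an initial segment needs an argument: induction on the
  smaller ordinal, with the larger one arbitrary.\<close>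

lemma rank_ge_downward_closed:
  assumes "rank_ge \<I> G M \<phi> a \<alpha> A" "\<beta> \<le> \<alpha>"
  shows "rank_ge \<I> G M \<phi> a \<beta> A"
  using assms
proof (induction \<beta> arbitrary: \<alpha> A rule: less_induct)
  case (less \<beta>)
  consider "is_zero_ord \<beta>" | \<gamma> where "is_succ_ord \<gamma> \<beta>" | "is_limit_ord \<beta>"
    unfolding is_limit_ord_def by blast
  then show ?case
  proof cases
    case 1
    then show ?thesis by (rule rank_ge.zero)
  next
    case 3
    then show ?thesis
    proof (rule rank_ge.limit)
      fix \<gamma> assume "\<gamma> < \<beta>"
      then show "rank_ge \<I> G M \<phi> a \<gamma> A"
        using less.IH[of \<gamma> \<alpha> A] less.prems by simp
    qed
  next
    case (2 \<gamma>)
    show ?thesis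
    proof (cases "\<beta> = \<alpha>")
      case True
      then show ?thesis using less.prems by simp
    next
      case False
      with less.prems have "\<beta> < \<alpha>" by simp
      from less.prems(1) show ?thesis
      proof cases
        case zero
        then show ?thesis
          using \<open>\<beta> < \<alpha>\<close> by (meson is_zero_ord_def not_less)
      next
        case limit
        then show ?thesis using \<open>\<beta> < \<alpha>\<close> by blast
      next
        case (succ \<delta> B)
        \<comment> \<open>A witness \<open>B\<close> for rank at least \<open>\<delta> + 1\<close> is one for \<open>\<gamma> + 1\<close>, as \<open>\<gamma> \<le> \<delta>\<close>.\<close>
        have "\<gamma> < \<beta>"
          using 2 by (simp add: is_succ_ord_def)
        moreover have "\<beta> \<le> \<delta>"
          using succ(1) \<open>\<beta> < \<alpha>\<close> unfolding is_succ_ord_def by (meson not_less)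
        ultimately have "rank_ge \<I> G M \<phi> a \<gamma> B"
          using less.IH[of \<gamma> \<delta> B] succ by simp
        then show ?thesis
          by (rule rank_ge.succ[OF 2 succ(2-5)])
      qed
    qed
  qed
qed

lemma perp_rank_mono:
  assumes "\<And>\<alpha>::'o::wellorder. rank_ge \<I> G M \<phi> a \<alpha> A \<Longrightarrow> rank_ge \<J> G M \<phi> a \<alpha> A"
  shows "(perp_rank \<I> G M \<phi> a A :: 'o extended) \<le> perp_rank \<J> G M \<phi> a A"
proof (cases "\<forall>\<alpha>::'o. rank_ge \<J> G M \<phi> a \<alpha> A")
  case True
  then show ?thesis by (simp add: perp_rank_def)
next
  case False
  then obtain \<gamma> :: 'o where \<gamma>: "\<not> rank_ge \<J> G M \<phi> a \<gamma> A" by blast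
  let ?bound = "\<lambda>\<I> \<beta>::'o. \<forall>\<alpha>. rank_ge \<I> G M \<phi> a \<alpha> A \<longrightarrow> \<alpha> \<le> \<beta>"
  \<comment> \<open>An ordinal that the rank does not reach bounds those that it reaches, so the
    set of upper bounds whose least element is taken is nonempty.\<close>
  have "?bound \<J> \<gamma>"
    using \<gamma> rank_ge_downward_closed by (metis linear)
  then have "?bound \<J> (LEAST \<beta>. ?bound \<J> \<beta>)"
    by (rule LeastI)
  then have "(LEAST \<beta>. ?bound \<I> \<beta>) \<le> (LEAST \<beta>. ?bound \<J> \<beta>)"
    using assms by (intro Least_le) blast
  moreover have "\<not> (\<forall>\<alpha>::'o. rank_ge \<I> G M \<phi> a \<alpha> A)"
    using assms \<gamma> by blast
  ultimately show ?thesis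
    using False by (simp add: perp_rank_def)
qed

lemma (in sigma_compact_group) perp_le_meager_scheme:
  assumes "strongly_admissible G T \<I>"
  shows "perp_le TYPE('m) TYPE('o::wellorder) G T \<I> (meager_scheme T)"
  unfolding perp_le_def
proof (intro allI impI, elim conjE)
  fix M :: "'m set" and \<phi> a A
  assume M: "G_structure G T M \<phi>" and sub: "set a \<subseteq> M" "A \<subseteq> M"
  show "(perp_rank \<I> G M \<phi> a A :: 'o extended) \<le> perp_rank (meager_scheme T) G M \<phi> a A"
    using indep_nm_imp_indep[OF assms M sub(1)] sub(2)
    by (auto simp: indep_meager_scheme intro!: perp_rank_mono elim!: rank_ge_mono_scheme)
qed

theorem theorem18:
  fixes G :: "('g, 'z) monoid_scheme" and T :: "'g topology"
  assumes "sigma_compact_Polish_group G T"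
  shows
    "(\<forall>(M :: 'm set) \<phi> a b C.
        G_structure G T M \<phi> \<and> finite a \<and> a \<subseteq> M \<and> finite b \<and> b \<subseteq> M \<and> finite C \<and> C \<subseteq> M \<longrightarrow>
        (indep_nm G T \<phi> a C b \<longleftrightarrow> indep_o G T \<phi> a C b)) \<and>
     strongly_admissible G T (meager_scheme T) \<and>
     (\<forall>\<I>. strongly_admissible G T \<I> \<longrightarrow>
        perp_le TYPE('m) TYPE('o::wellorder) G T \<I> (meager_scheme T))"
proof -
  interpret sigma_compact_group G T
    using assms by unfold_locales (auto simp: sigma_compact_Polish_group_def Polish_space_def)
  show ?thesis
    using indep_nm_iff_indep_o strongly_admissible_meager_scheme perp_le_meager_scheme by blast
qed

end
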